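(* Assume that every superbalanced holographic entropy inequality (HEI) is TF-compatible. Let $Q\ge0$ be a primitive superbalanced HEI on $\mathsf N$ parties, written (after a suitable rescaling) in the maximally reduced form $$\sum_{\ell=1}^{m_L}S(X_\ell)\ \ge\ \sum_{r=1}^{m_R}S(Y_r),$$ where all terms have coefficient $+1$, repetitions within a side are allowed, and no subsystem appears on both sides. Then: (1) for every $\ell$ there is an $r$ with $X_\ell\subsetneq Y_r$; more strongly (region dominance), for every subsystem $Z\subseteq[\mathsf N]$ the number of left-hand terms containing $Z$ is at most the number of right-hand terms containing $Z$, i.e. $|\{\ell: X_\ell\supseteq Z\}|\le|\{r: Y_r\supseteq Z\}|$ (counted with repetition); (2) for every $\ell$ there is an $r$ with $Y_r\subsetneq X_\ell$.
   Context: Let $[\mathsf N]=\{1,\dots,\mathsf N\}$ label $\mathsf N$ parties (disjoint spatial boundary regions). An information quantity is a linear combination $Q=\sum_{\emptyset\ne X\subseteq[\mathsf N]}q_X\,S(X)$ of the entanglement entropies $S(X)$ of the composite subsystems $X$, with $S(\emptyset)=0$. Juxtaposition of subsystems denotes union. A geometric state is a state of a holographic CFT that encodes a classical bulk geometry (asymptotically AdS, obeying Einstein's equation and the null energy condition). A holographic entropy inequality (HEI) is an inequality $Q\ge0$ that holds for every geometric state and every choice of the regions. It is primitive if it cannot be obtained as a conical combination of other HEIs; primitive HEIs have rational coefficients, which may be rescaled to integers. In the reduced form each $X$ with $q_X>0$ appears $q_X$ times on the left and each $X$ with $q_X<0$ appears $|q_X|$ times on the right. $Q$ is superbalanced if $\sum_{X\ni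 i}q_X=0$ for every party $i\in[\mathsf N]$ and $\sum_{X\supseteq\{i,j\}}q_X=0$ for every pair of distinct parties $i,j\in[\mathsf N]$. For pairwise disjoint subsystems $X,Y,Z,W\subseteq[\mathsf N]$ with $X,Y,Z$ non-empty, $$I_3(X:Y:Z\,|\,W)=S(XW)+S(YW)+S(ZW)+S(XYZW)-S(XYW)-S(XZW)-S(YZW)-S(W).$$ $Q$ is TF-compatible if it equals a finite sum $\sum_i -I_3(X_i:Y_i:Z_i\,|\,W_i)$ of such terms ($W_i=\emptyset$ and repeated terms allowed). *)

theory Defs
  imports Complex_Main "HOL-Analysis.Sigma_Algebra"
begin

(* Holographic CFT states dual to classical bulk geometries are not available as a
   construction, so the class of geometric states is a parameter: a set G of states, where
   state s lives on the boundary space bdry s, has an algebra of admissible spatial boundary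
   regions, and assigns to each region A the (regulated) entanglement entropy S s A.
   As usual the boundary is taken to include the purifying system, i.e. the state is pure on
   all of bdry s, so that a region and its complement have the same entropy. *)
locale geometric_states =
  fixes G :: "'s set"
    and bdry :: "'s \<Rightarrow> 'p set"
    and regions :: "'s \<Rightarrow> 'p set set"
    and S :: "'s \<Rightarrow> 'p set \<Rightarrow> real"
  assumes regions_algebra: "s \<in> G \<Longrightarrow> algebra (bdry s) (regions s)"
    and entropy_empty: "s \<in> G \<Longrightarrow> S s {} = 0"
    and entropy_pure: "s \<in> G \<Longrightarrow> A \<in> regions s \<Longrightarrow> S s (bdry s - A) = S s A"

definition subsystems :: "nat \<Rightarrow> nat set set" where
  "subsystems N = {X. X \<noteq> {} \<and> X \<subseteq> {1..N}}"

(* An information quantity is identified with its coefficient vector q, which is set to 0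
   off the non-empty subsystems, so that equality of quantities is equality of functions. *)
definition info_quantity :: "nat \<Rightarrow> (nat set \<Rightarrow> real) \<Rightarrow> bool" where
  "info_quantity N q \<longleftrightarrow> (\<forall>X. X \<notin> subsystems N \<longrightarrow> q X = 0)"

(* A choice of regions is a disjoint family of admissible regions. It need not cover the
   boundary, the remainder being the purifier, and empty regions are allowed. *)
definition HEI ::
  "'s set \<Rightarrow> ('s \<Rightarrow> 'p set set) \<Rightarrow> ('s \<Rightarrow> 'p set \<Rightarrow> real) \<Rightarrow> nat \<Rightarrow> (nat set \<Rightarrow> real) \<Rightarrow> bool" where
  "HEI G regions S N q \<longleftrightarrow> info_quantity N q \<and>
     (\<forall>s\<in>G. \<forall>A. (\<forall>i\<in>{1..N}. A i \<in> regions s) \<and> disjoint_family_on A {1..N} \<longrightarrow>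
        (\<Sum>X\<in>subsystems N. q X * S s (\<Union>i\<in>X. A i)) \<ge> 0)"

(* Inequalities differing by a positive factor are the same inequality, so the "other" HEIs
   are those that are not positive multiples of q. The empty combination excludes q = 0. *)
definition primitive_HEI ::
  "'s set \<Rightarrow> ('s \<Rightarrow> 'p set set) \<Rightarrow> ('s \<Rightarrow> 'p set \<Rightarrow> real) \<Rightarrow> nat \<Rightarrow> (nat set \<Rightarrow> real) \<Rightarrow> bool" where
  "primitive_HEI G regions S N q \<longleftrightarrow> HEI G regions S N q \<and>
     \<not> (\<exists>(K :: nat set) p c. finite K \<and>
          (\<forall>k\<in>K. HEI G regions S N (p k) \<and> \<not> (\<exists>t>0. p k = (\<lambda>X. t * q X)) \<and> c k \<ge> 0) \<and>
          q = (\<lambda>X. \<Sum>k\<in>K. c k * p k X))"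

definition superbalanced :: "nat \<Rightarrow> (nat set \<Rightarrow> real) \<Rightarrow> bool" where
  "superbalanced N q \<longleftrightarrow>
     (\<forall>i\<in>{1..N}. (\<Sum>X\<in>{X \<in> subsystems N. i \<in> X}. q X) = 0) \<and>
     (\<forall>i\<in>{1..N}. \<forall>j\<in>{1..N}. i \<noteq> j \<longrightarrow>
        (\<Sum>X\<in>{X \<in> subsystems N. {i, j} \<subseteq> X}. q X) = 0)"

(* Coefficient vector of the single entropy S(X); it vanishes for X = {} since S({}) = 0. *)
definition entropy_term :: "nat set \<Rightarrow> nat set \<Rightarrow> real" where
  "entropy_term X V = (if X \<noteq> {} \<and> V = X then 1 else 0)"

definition I3 :: "nat set \<Rightarrow> nat set \<Rightarrow> nat set \<Rightarrow> nat set \<Rightarrow> nat set \<Rightarrow> real" where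
  "I3 X Y Z W V =
     entropy_term (X \<union> W) V + entropy_term (Y \<union> W) V + entropy_term (Z \<union> W) V
     + entropy_term (X \<union> Y \<union> Z \<union> W) V
     - entropy_term (X \<union> Y \<union> W) V - entropy_term (X \<union> Z \<union> W) V - entropy_term (Y \<union> Z \<union> W) V
     - entropy_term W V"

definition I3_args :: "nat \<Rightarrow> nat set \<Rightarrow> nat set \<Rightarrow> nat set \<Rightarrow> nat set \<Rightarrow> bool" where
  "I3_args N X Y Z W \<longleftrightarrow>
     X \<in> subsystems N \<and> Y \<in> subsystems N \<and> Z \<in> subsystems N \<and> W \<subseteq> {1..N} \<and>
     X \<inter> Y = {} \<and> X \<inter> Z = {} \<and> X \<inter> W = {} \<and> Y \<inter> Z = {} \<and> Y \<inter> W = {} \<and> Z \<inter> W = {}"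

definition TF_compatible :: "nat \<Rightarrow> (nat set \<Rightarrow> real) \<Rightarrow> bool" where
  "TF_compatible N q \<longleftrightarrow>
     (\<exists>ts. (\<forall>(X, Y, Z, W)\<in>set ts. I3_args N X Y Z W) \<and>
           q = (\<lambda>V. \<Sum>(X, Y, Z, W)\<leftarrow>ts. - I3 X Y Z W V))"

(* Sums of unit-coefficient I3 terms have integer coefficients, so the TF property of an
   inequality only makes sense for rational coefficients and up to positive rescaling. *)
definition superbalanced_HEIs_TF ::
  "'s set \<Rightarrow> ('s \<Rightarrow> 'p set set) \<Rightarrow> ('s \<Rightarrow> 'p set \<Rightarrow> real) \<Rightarrow> bool" where
  "superbalanced_HEIs_TF G regions S \<longleftrightarrow>
     (\<forall>N p. HEI G regions S N p \<and> superbalanced N p \<and> (\<forall>X. p X \<in> \<rat>) \<longrightarrow>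
        (\<exists>c>0. TF_compatible N (\<lambda>X. c * p X)))"

(* Some positive multiple of Q is the sum of S(X l), l = 1..mL, minus the sum of S(Y r),
   r = 1..mR; repetitions are allowed on each side. *)
definition reduced_form ::
  "nat \<Rightarrow> (nat set \<Rightarrow> real) \<Rightarrow> nat \<Rightarrow> (nat \<Rightarrow> nat set) \<Rightarrow> nat \<Rightarrow> (nat \<Rightarrow> nat set) \<Rightarrow> bool" where
  "reduced_form N Q mL X mR Y \<longleftrightarrow>
     X ` {1..mL} \<subseteq> subsystems N \<and> Y ` {1..mR} \<subseteq> subsystems N \<and>
     X ` {1..mL} \<inter> Y ` {1..mR} = {} \<and>
     (\<exists>c>0. \<forall>V. c * Q V =
        (\<Sum>l\<in>{1..mL}. entropy_term (X l) V) - (\<Sum>r\<in>{1..mR}. entropy_term (Y r) V))"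

end

theory Submission
  imports Defs
begin

text \<open>For a fixed \<open>Z\<close>, the coefficients of the terms of \<open>- I3\<close> that contain \<open>Z\<close> add up to
  \<open>-1\<close> or \<open>0\<close>, so TF-compatibility gives region dominance, and dominance at \<open>Z = X l\<close> gives the
  larger right-hand term. For the smaller one, pick a party \<open>i\<close> in \<open>X l\<close> and exchange \<open>i\<close> with the
  purifier. Purity turns the inequality into another superbalanced HEI, in which every term
  containing \<open>i\<close> is replaced by its complement together with \<open>i\<close>. This reverses inclusions between
  such terms, so the first part applied to the new inequality yields a \<open>Y r\<close> below \<open>X l\<close>.\<close>

text \<open>The coefficient vector of a reduced form. Keeping the two families of terms as arguments
  lets a relabelling of subsystems act term by term.\<close>

definition term_difference ::
  "nat \<Rightarrow> (nat \<Rightarrow> nat set) \<Rightarrow> nat \<Rightarrow> (nat \<Rightarrow> nat set) \<Rightarrow> nat set \<Rightarrow> real" where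
  "term_difference mL X mR Y V =
     (\<Sum>l\<in>{1..mL}. entropy_term (X l) V) - (\<Sum>r\<in>{1..mR}. entropy_term (Y r) V)"

text \<open>The effect of exchanging party \<open>i\<close> with the purifier: a subsystem that then contains the
  purifier is represented by its complement.\<close>

definition purifier_swap :: "nat \<Rightarrow> nat \<Rightarrow> nat set \<Rightarrow> nat set" where
  "purifier_swap N i V = (if i \<in> V then insert i ({1..N} - V) else V)"

section \<open>Subsystems and pairings of coefficient vectors with weights\<close>

lemma finite_subsystems: "finite (subsystems N)"
  by (rule finite_subset[of _ "Pow {1..N}"]) (auto simp: subsystems_def)

lemma purifier_swap_mem_subsystems:
  "V \<in> subsystems N \<Longrightarrow> purifier_swap N i V \<in> subsystems N"
  by (auto simp: subsystems_def purifier_swap_def)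

text \<open>Since \<open>purifier_swap\<close> preserves membership of \<open>i\<close>, the
  inclusion forces \<open>i\<close> into \<open>U\<close> as well. Both sides are then complements
  with \<open>i\<close> added, and complementation reverses inclusion.\<close>

lemma psubset_of_purifier_swap:
  assumes "i \<in> V" "V \<in> subsystems N" "U \<in> subsystems N" "U \<noteq> V"
    and "purifier_swap N i V \<subseteq> purifier_swap N i U"
  shows "U \<subset> V"
  using assms by (auto simp: subsystems_def purifier_swap_def split: if_splits)

lemma sum_entropy_term_mult:
  assumes "W \<in> subsystems N"
  shows "(\<Sum>V\<in>subsystems N. entropy_term W V * f V) = f W"
proof -
  have "W \<noteq> {}" using assms by (simp add: subsystems_def)
  then have "(\<Sum>V\<in>subsystems N. entropy_term W V * f V)
      = (\<Sum>V\<in>subsystems N. if W = V then f V else 0)"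
    by (intro sum.cong) (auto simp: entropy_term_def)
  then show ?thesis using assms by (simp add: finite_subsystems)
qed

text \<open>Turns sums over coefficients back into sums over terms. The weight \<open>f\<close> will
  be an indicator of supersets or an entropy, possibly composed with the swap.\<close>

lemma sum_term_difference_mult:
  assumes "X ` {1..mL} \<subseteq> subsystems N" "Y ` {1..mR} \<subseteq> subsystems N"
  shows "(\<Sum>V\<in>subsystems N. term_difference mL X mR Y V * f V)
    = (\<Sum>l\<in>{1..mL}. f (X l)) - (\<Sum>r\<in>{1..mR}. f (Y r))"
proof -
  have swap: "(\<Sum>V\<in>subsystems N. (\<Sum>k\<in>{1..m}. entropy_term (T k) V) * f V)
      = (\<Sum>k\<in>{1..m}. f (T k))" if "T ` {1..m} \<subseteq> subsystems N" for T m
  proof -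
    have "(\<Sum>V\<in>subsystems N. (\<Sum>k\<in>{1..m}. entropy_term (T k) V) * f V)
      = (\<Sum>k\<in>{1..m}. \<Sum>V\<in>subsystems N. entropy_term (T k) V * f V)"
      unfolding sum_distrib_right by (rule sum.swap)
    also have "\<dots> = (\<Sum>k\<in>{1..m}. f (T k))"
      using that by (intro sum.cong refl sum_entropy_term_mult) auto
    finally show ?thesis .
  qed
  show ?thesis
    using swap[OF assms(1)] swap[OF assms(2)]
    by (simp add: term_difference_def left_diff_distrib sum_subtractf)
qed

text \<open>Brings the restricted sums of \<open>superbalanced\<close> into the form of a pairing
  with a weight.\<close>

lemma sum_filter_subsystems:
  fixes q :: "nat set \<Rightarrow> real"
  shows "(\<Sum>V\<in>{V \<in> subsystems N. P V}. q V) = (\<Sum>V\<in>subsystems N. q V * of_bool (P V))"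
  by (simp add: finite_subsystems sum.inter_filter of_bool_def if_distrib cong: if_cong)

lemma term_difference_rational: "term_difference mL X mR Y V \<in> \<rat>"
  unfolding term_difference_def entropy_term_def by (intro Rats_diff Rats_sum) auto

lemma info_quantity_term_difference:
  assumes "X ` {1..mL} \<subseteq> subsystems N" "Y ` {1..mR} \<subseteq> subsystems N"
  shows "info_quantity N (term_difference mL X mR Y)"
  unfolding info_quantity_def
proof (intro allI impI)
  fix V assume V: "V \<notin> subsystems N"
  have "entropy_term (X l) V = 0" if "l \<in> {1..mL}" for l
    using that assms V unfolding entropy_term_def by (metis image_subset_iff)
  moreover have "entropy_term (Y r) V = 0" if "r \<in> {1..mR}" for r
    using that assms V unfolding entropy_term_def by (metis image_subset_iff)
  ultimately show "term_difference mL X mR Y V = 0"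
    by (simp add: term_difference_def)
qed

section \<open>Region dominance from TF-compatibility\<close>

lemma sum_supersets_entropy_term:
  assumes "W \<subseteq> {1..N}"
  shows "(\<Sum>V\<in>subsystems N. entropy_term W V * of_bool (Z \<subseteq> V)) = of_bool (W \<noteq> {} \<and> Z \<subseteq> W)"
proof (cases "W = {}")
  case False
  then show ?thesis
    using assms sum_entropy_term_mult[of W N "\<lambda>V. of_bool (Z \<subseteq> V)"] by (simp add: subsystems_def)
qed (simp add: entropy_term_def)

text \<open>Inclusion-exclusion: the sum is 1 if \<open>Z\<close> lies in the union of the four sets
  and meets each of \<open>A\<close>, \<open>B\<close>, \<open>C\<close>, and 0 otherwise. The one
  exception is \<open>Z = W = {}\<close>, where the vanishing term for \<open>W\<close> makes it
  1.\<close>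

lemma sum_supersets_I3_nonneg:
  assumes "I3_args N A B C W"
  shows "0 \<le> (\<Sum>V\<in>subsystems N. I3 A B C W V * of_bool (Z \<subseteq> V))"
proof -
  have sub: "A \<subseteq> {1..N}" "B \<subseteq> {1..N}" "C \<subseteq> {1..N}" "W \<subseteq> {1..N}"
    and ne: "A \<noteq> {}" "B \<noteq> {}" "C \<noteq> {}"
    using assms by (auto simp: I3_args_def subsystems_def)
  define e :: "nat set \<Rightarrow> real" where "e U = of_bool (U \<noteq> {} \<and> Z \<subseteq> U)" for U
  have "(\<Sum>V\<in>subsystems N. I3 A B C W V * of_bool (Z \<subseteq> V))
      = e (A \<union> W) + e (B \<union> W) + e (C \<union> W) + e (A \<union> B \<union> C \<union> W)
        - e (A \<union> B \<union> W) - e (A \<union> C \<union> W) - e (B \<union> C \<union> W) - e W"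
    using sub unfolding I3_def e_def
    by (simp only: distrib_right left_diff_distrib sum.distrib sum_subtractf
        sum_supersets_entropy_term Un_subset_iff simp_thms)
  also have "\<dots> \<ge> 0"
  proof -
    have disj: "A \<inter> B = {}" "A \<inter> C = {}" "B \<inter> C = {}" "A \<inter> W = {}" "B \<inter> W = {}" "C \<inter> W = {}"
      using assms by (auto simp: I3_args_def)
    show ?thesis
    proof (cases "Z \<subseteq> A \<union> B \<union> C \<union> W")
      case True
      \<comment> \<open>By disjointness, whether \<open>Z\<close> fits into a partial union depends
        only on which blocks it misses. Apart from the exception, the sum becomes the expansion of
        (1-a)(1-b)(1-c).\<close>
      define a b c where "a \<longleftrightarrow> Z \<inter> A = {}" and "b \<longleftrightarrow> Z \<inter> B = {}" and "c \<longleftrightarrow> Z \<inter> C = {}"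
      have "Z \<subseteq> A \<union> W \<longleftrightarrow> b \<and> c" "Z \<subseteq> B \<union> W \<longleftrightarrow> a \<and> c" "Z \<subseteq> C \<union> W \<longleftrightarrow> a \<and> b"
        "Z \<subseteq> A \<union> B \<union> W \<longleftrightarrow> c" "Z \<subseteq> A \<union> C \<union> W \<longleftrightarrow> b" "Z \<subseteq> B \<union> C \<union> W \<longleftrightarrow> a"
        "Z \<subseteq> W \<longleftrightarrow> a \<and> b \<and> c"
        using True disj unfolding a_def b_def c_def by blast+
      then show ?thesis
        using True ne by (simp add: e_def of_bool_def)
    next
      case False
      then have "\<not> Z \<subseteq> A \<union> W" "\<not> Z \<subseteq> B \<union> W" "\<not> Z \<subseteq> C \<union> W" "\<not> Z \<subseteq> A \<union> B \<union> W"
        "\<not> Z \<subseteq> A \<union> C \<union> W" "\<not> Z \<subseteq> B \<union> C \<union> W" "\<not> Z \<subseteq> W"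
        by blast+
      then show ?thesis using False by (simp add: e_def)
    qed
  qed
  finally show ?thesis .
qed

lemma sum_supersets_TF_compatible_nonpos:
  assumes "TF_compatible N q"
  shows "(\<Sum>V\<in>subsystems N. q V * of_bool (Z \<subseteq> V)) \<le> 0"
proof -
  obtain ts where ts: "\<forall>(A, B, C, W)\<in>set ts. I3_args N A B C W"
    and q: "q = (\<lambda>V. \<Sum>(A, B, C, W)\<leftarrow>ts. - I3 A B C W V)"
    using assms by (auto simp: TF_compatible_def)
  have "(\<Sum>V\<in>subsystems N. (\<Sum>(A, B, C, W)\<leftarrow>ts. - I3 A B C W V) * of_bool (Z \<subseteq> V)) \<le> 0"
    using ts
  proof (induction ts)
    case (Cons t ts)
    obtain A B C W where t: "t = (A, B, C, W)" by (cases t) auto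
    have "0 \<le> (\<Sum>V\<in>subsystems N. I3 A B C W V * of_bool (Z \<subseteq> V))"
      using Cons.prems t by (intro sum_supersets_I3_nonneg) auto
    then show ?case
      using Cons t by (simp add: distrib_right left_diff_distrib sum.distrib sum_subtractf)
  qed simp
  then show ?thesis by (simp add: q)
qed

text \<open>The difference of the two counts is the pairing with the indicator of supersets of
  \<open>Z\<close>. The TF hypothesis applies because the coefficients are rational; it concerns
  only a positive multiple, which leaves the sign unchanged.\<close>

lemma region_dominance:
  assumes TF: "superbalanced_HEIs_TF G regions S"
    and X: "X ` {1..mL} \<subseteq> subsystems N" and Y: "Y ` {1..mR} \<subseteq> subsystems N"
    and hei: "HEI G regions S N (term_difference mL X mR Y)"
    and bal: "superbalanced N (term_difference mL X mR Y)"
  shows "card {l \<in> {1..mL}. Z \<subseteq> X l} \<le> card {r \<in> {1..mR}. Z \<subseteq> Y r}"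
proof -
  obtain c where "c > 0" and tf: "TF_compatible N (\<lambda>V. c * term_difference mL X mR Y V)"
    using TF hei bal term_difference_rational unfolding superbalanced_HEIs_TF_def by blast
  have "c * (\<Sum>V\<in>subsystems N. term_difference mL X mR Y V * of_bool (Z \<subseteq> V)) \<le> 0"
    using sum_supersets_TF_compatible_nonpos[OF tf, of Z]
    by (simp add: sum_distrib_left mult.assoc)
  then have "(\<Sum>V\<in>subsystems N. term_difference mL X mR Y V * of_bool (Z \<subseteq> V)) \<le> 0"
    using \<open>c > 0\<close> by (simp add: mult_le_0_iff)
  then have "(\<Sum>l\<in>{1..mL}. of_bool (Z \<subseteq> X l)) \<le> (\<Sum>r\<in>{1..mR}. of_bool (Z \<subseteq> Y r) :: real)"
    unfolding sum_term_difference_mult[OF X Y] by simp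
  then show ?thesis
    by (simp add: sum.inter_filter[symmetric] of_bool_def Int_def)
qed

text \<open>The term \<open>X l\<close> counts itself, so the left count at \<open>Z = X l\<close>
  is positive. Strictness comes later, from the disjointness of the two sides.\<close>

lemma dominating_term:
  assumes "superbalanced_HEIs_TF G regions S"
    and "X ` {1..mL} \<subseteq> subsystems N" "Y ` {1..mR} \<subseteq> subsystems N"
    and "HEI G regions S N (term_difference mL X mR Y)"
    and "superbalanced N (term_difference mL X mR Y)"
    and "l \<in> {1..mL}"
  shows "\<exists>r\<in>{1..mR}. X l \<subseteq> Y r"
proof -
  have "0 < card {k \<in> {1..mL}. X l \<subseteq> X k}"
    using \<open>l \<in> {1..mL}\<close> by (auto simp: card_gt_0_iff)
  also have "\<dots> \<le> card {r \<in> {1..mR}. X l \<subseteq> Y r}"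
    by (rule region_dominance) (use assms in auto)
  finally show ?thesis by (auto simp: card_gt_0_iff)
qed

section \<open>Passing from \<open>Q\<close> to its reduced form by rescaling\<close>

lemma HEI_scale:
  assumes "HEI G regions S N q" "0 \<le> c"
  shows "HEI G regions S N (\<lambda>V. c * q V)"
  using assms
  by (auto simp: HEI_def info_quantity_def mult.assoc sum_distrib_left[symmetric])

lemma superbalanced_scale:
  assumes "superbalanced N q"
  shows "superbalanced N (\<lambda>V. c * q V)"
  using assms by (simp add: superbalanced_def sum_distrib_left[symmetric])

section \<open>Exchange of a party with the purifier\<close>

context geometric_states
begin

text \<open>Party \<open>i\<close> is handed the purifying region. If \<open>i\<close> is in
  \<open>V\<close>, the new region of \<open>V\<close> is the complement of the old region of the
  swapped subsystem, and purity equates the entropies; otherwise nothing changes.\<close>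

lemma entropy_purifier_swap:
  assumes s: "s \<in> G" and A: "\<forall>j\<in>{1..N}. A j \<in> regions s" and disj: "disjoint_family_on A {1..N}"
    and i: "i \<in> {1..N}" and V: "V \<in> subsystems N"
  shows "S s (\<Union>j\<in>purifier_swap N i V. A j)
    = S s (\<Union>j\<in>V. (A(i := bdry s - (\<Union>k\<in>{1..N}. A k))) j)"
proof (cases "i \<in> V")
  case True
  interpret algebra "bdry s" "regions s" using regions_algebra[OF s] .
  have Vsub: "V \<subseteq> {1..N}" using V by (simp add: subsystems_def)
  have sub: "A j \<subseteq> bdry s" if "j \<in> {1..N}" for j
    using A that sets_into_space by blast
  have mem: "(\<Union>j\<in>purifier_swap N i V. A j) \<in> regions s"
    using purifier_swap_mem_subsystems[OF V, of i] A
    by (intro finite_UN) (auto simp: subsystems_def dest: finite_subset[OF _ finite_atLeastAtMost])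
  have "(\<Union>j\<in>V. (A(i := bdry s - (\<Union>k\<in>{1..N}. A k))) j)
      = (bdry s - (\<Union>k\<in>{1..N}. A k)) \<union> (\<Union>j\<in>V - {i}. A j)"
    using True by (auto split: if_splits)
  also have "\<dots> = bdry s - (\<Union>j\<in>purifier_swap N i V. A j)"
  proof (rule set_eqI)
    fix x
    have uniq: "j = k" if "j \<in> {1..N}" "k \<in> {1..N}" "x \<in> A j" "x \<in> A k" for j k
      using disj that unfolding disjoint_family_on_def by blast
    show "x \<in> (bdry s - (\<Union>k\<in>{1..N}. A k)) \<union> (\<Union>j\<in>V - {i}. A j)
        \<longleftrightarrow> x \<in> bdry s - (\<Union>j\<in>purifier_swap N i V. A j)"
    \<comment> \<open>A boundary point lies in exactly one \<open>A k\<close> or in the purifying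
      region. In the first case both sides say that \<open>k\<close> is in \<open>V\<close> and
      differs from \<open>i\<close>; in the second both sides hold.\<close>
    proof (cases "\<exists>k\<in>{1..N}. x \<in> A k")
      case True
      then obtain k where k: "k \<in> {1..N}" "x \<in> A k" by blast
      have other: "x \<in> A j \<longleftrightarrow> j = k" if "j \<in> {1..N}" for j
        using uniq k that by blast
      have "x \<in> (\<Union>j\<in>V - {i}. A j) \<longleftrightarrow> k \<in> V - {i}"
        using other Vsub by blast
      moreover have "x \<in> (\<Union>j\<in>purifier_swap N i V. A j) \<longleftrightarrow> k = i \<or> k \<notin> V"
        using other k \<open>i \<in> V\<close> i by (auto simp: purifier_swap_def)
      moreover have "x \<in> bdry s" using sub k by blast
      ultimately show ?thesis using k by blast
    next
      case False
      then show ?thesis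
        using Vsub i \<open>i \<in> V\<close> by (auto simp: purifier_swap_def)
    qed
  qed
  finally show ?thesis using entropy_pure[OF s mem] by simp
next
  case False
  then have "(\<Union>j\<in>V. (A(i := bdry s - (\<Union>k\<in>{1..N}. A k))) j) = (\<Union>j\<in>V. A j)"
    by (intro SUP_cong) auto
  then show ?thesis using False by (simp add: purifier_swap_def)
qed

text \<open>The given inequality holds for every choice of regions, in particular for the choice
  \<open>B\<close> in which \<open>i\<close> and the purifier have traded places. Rewriting its
  entropies in terms of \<open>A\<close> gives the swapped inequality.\<close>

lemma HEI_purifier_swap:
  assumes X: "X ` {1..mL} \<subseteq> subsystems N" and Y: "Y ` {1..mR} \<subseteq> subsystems N"
    and hei: "HEI G regions S N (term_difference mL X mR Y)" and i: "i \<in> {1..N}"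
  shows "HEI G regions S N
    (term_difference mL (\<lambda>l. purifier_swap N i (X l)) mR (\<lambda>r. purifier_swap N i (Y r)))"
    (is "HEI _ _ _ _ (term_difference _ ?X _ ?Y)")
proof -
  have X': "?X ` {1..mL} \<subseteq> subsystems N" and Y': "?Y ` {1..mR} \<subseteq> subsystems N"
    using X Y purifier_swap_mem_subsystems by blast+
  have "(\<Sum>V\<in>subsystems N. term_difference mL ?X mR ?Y V * S s (\<Union>j\<in>V. A j)) \<ge> 0"
    if s: "s \<in> G" and A: "\<forall>j\<in>{1..N}. A j \<in> regions s" and disj: "disjoint_family_on A {1..N}"
    for s A
  proof -
    interpret algebra "bdry s" "regions s" using regions_algebra[OF s] .
    define B where "B = A(i := bdry s - (\<Union>k\<in>{1..N}. A k))"
    have "bdry s - (\<Union>k\<in>{1..N}. A k) \<in> regions s"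
      using A by (intro compl_sets finite_UN) auto
    then have "\<forall>j\<in>{1..N}. B j \<in> regions s"
      using A by (simp add: B_def)
    moreover have "disjoint_family_on B {1..N}"
      using disj unfolding disjoint_family_on_def B_def by auto
    ultimately have "0 \<le> (\<Sum>V\<in>subsystems N. term_difference mL X mR Y V * S s (\<Union>j\<in>V. B j))"
      using hei s unfolding HEI_def by blast
    also have "\<dots> = (\<Sum>l\<in>{1..mL}. S s (\<Union>j\<in>X l. B j)) - (\<Sum>r\<in>{1..mR}. S s (\<Union>j\<in>Y r. B j))"
      by (rule sum_term_difference_mult[OF X Y])
    also have "\<dots> = (\<Sum>l\<in>{1..mL}. S s (\<Union>j\<in>?X l. A j)) - (\<Sum>r\<in>{1..mR}. S s (\<Union>j\<in>?Y r. A j))"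
      unfolding B_def using X Y
      by (intro arg_cong2[where f = "(-)"] sum.cong refl
          entropy_purifier_swap[OF s A disj i, symmetric]) auto
    also have "\<dots> = (\<Sum>V\<in>subsystems N. term_difference mL ?X mR ?Y V * S s (\<Union>j\<in>V. A j))"
      by (rule sum_term_difference_mult[OF X' Y', symmetric])
    finally show ?thesis .
  qed
  then show ?thesis
    using info_quantity_term_difference[OF X' Y'] by (simp add: HEI_def)
qed

end

text \<open>After the swap, the indicators of containing one or two given parties are linear
  combinations of such indicators before the swap, and superbalance annihilates all of
  those.\<close>

lemma superbalanced_purifier_swap:
  assumes X: "X ` {1..mL} \<subseteq> subsystems N" and Y: "Y ` {1..mR} \<subseteq> subsystems N"
    and bal: "superbalanced N (term_difference mL X mR Y)" and i: "i \<in> {1..N}"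
  shows "superbalanced N
    (term_difference mL (\<lambda>l. purifier_swap N i (X l)) mR (\<lambda>r. purifier_swap N i (Y r)))"
    (is "superbalanced _ (term_difference _ ?X _ ?Y)")
proof -
  have X': "?X ` {1..mL} \<subseteq> subsystems N" and Y': "?Y ` {1..mR} \<subseteq> subsystems N"
    using X Y purifier_swap_mem_subsystems by blast+
  define w where "w f = (\<Sum>V\<in>subsystems N. term_difference mL X mR Y V * f V)"
    for f :: "nat set \<Rightarrow> real"
  define b1 where "b1 j V = (of_bool (j \<in> V) :: real)" for j :: nat and V
  define b2 where "b2 j k V = (of_bool ({j, k} \<subseteq> V) :: real)" for j k :: nat and V
  \<comment> \<open>Relabelling the terms amounts to precomposing the weight with the swap.\<close>
  have w_swap: "(\<Sum>V\<in>subsystems N. term_difference mL ?X mR ?Y V * f V)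
      = w (\<lambda>V. f (purifier_swap N i V))" for f
    unfolding w_def by (simp only: sum_term_difference_mult[OF X Y] sum_term_difference_mult[OF X' Y'])
  have w_add: "w (\<lambda>V. f V + g V) = w f + w g" and w_diff: "w (\<lambda>V. f V - g V) = w f - w g" for f g
    by (simp_all add: w_def distrib_left right_diff_distrib sum.distrib sum_subtractf)
  have w_double: "w (\<lambda>V. 2 * f V) = 2 * w f" for f
    by (simp add: w_def sum_distrib_left mult.left_commute)
  have w_cong: "w f = w g" if "\<And>V. V \<in> subsystems N \<Longrightarrow> f V = g V" for f g
    using that by (simp add: w_def)
  have w1: "w (b1 j) = 0" if "j \<in> {1..N}" for j
    using bal that unfolding superbalanced_def w_def b1_def sum_filter_subsystems by blast
  have w2: "w (b2 j k) = 0" if "j \<in> {1..N}" "k \<in> {1..N}" "j \<noteq> k" for j k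
    using bal that unfolding superbalanced_def w_def b2_def sum_filter_subsystems by blast
  have single: "w (\<lambda>V. b1 j (purifier_swap N i V)) = 0" if j: "j \<in> {1..N}" for j
  proof (cases "j = i")
    case True
    have "w (\<lambda>V. b1 j (purifier_swap N i V)) = w (b1 i)"
      using True by (intro w_cong) (auto simp: b1_def purifier_swap_def)
    then show ?thesis using w1[OF i] by simp
  next
    case False
    \<comment> \<open>The swapped subsystem contains \<open>j\<close> iff exactly one of
      \<open>i\<close>, \<open>j\<close> is in \<open>V\<close>. The product term in this exclusive
      or calls for pair balance even for a single party.\<close>
    have "w (\<lambda>V. b1 j (purifier_swap N i V)) = w (\<lambda>V. b1 j V + b1 i V - 2 * b2 i j V)"
      using False j by (intro w_cong) (auto simp: b1_def b2_def purifier_swap_def)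
    then show ?thesis using False i j by (simp add: w_add w_diff w_double w1 w2)
  qed
  have with_i: "w (\<lambda>V. b2 i j (purifier_swap N i V)) = 0" if "j \<in> {1..N}" "j \<noteq> i" for j
  proof -
    have "w (\<lambda>V. b2 i j (purifier_swap N i V)) = w (\<lambda>V. b1 i V - b2 i j V)"
      using that by (intro w_cong) (auto simp: b1_def b2_def purifier_swap_def)
    then show ?thesis using that i by (simp add: w_diff w1 w2)
  qed
  have pair: "w (\<lambda>V. b2 j k (purifier_swap N i V)) = 0"
    if jk: "j \<in> {1..N}" "k \<in> {1..N}" "j \<noteq> k" for j k
  proof -
    consider "j = i" | "k = i" | "j \<noteq> i" "k \<noteq> i" by blast
    then show ?thesis
    proof cases
      case 1
      then show ?thesis using with_i jk by simp
    next
      case 2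
      have "b2 j i = b2 i j" by (auto simp: b2_def)
      then show ?thesis using with_i[of j] jk 2 by simp
    next
      case 3
      \<comment> \<open>The case \<open>i\<close> in \<open>V\<close> contributes the indicator that
        \<open>j\<close> and \<open>k\<close> are both missing, the other case that both are
        present. Their triple products cancel, so pair balance suffices.\<close>
      have "w (\<lambda>V. b2 j k (purifier_swap N i V)) = w (\<lambda>V. b2 j k V + b1 i V - b2 i j V - b2 i k V)"
        using 3 jk by (intro w_cong) (auto simp: b1_def b2_def purifier_swap_def)
      then show ?thesis using 3 i jk by (simp add: w_add w_diff w1 w2)
    qed
  qed
  show ?thesis
    unfolding superbalanced_def sum_filter_subsystems w_swap
    using single pair by (simp add: b1_def b2_def)
qed

theorem mainTheorem4:
  fixes G :: "'s set"
    and bdry :: "'s \<Rightarrow> 'p set"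
    and regions :: "'s \<Rightarrow> 'p set set"
    and S :: "'s \<Rightarrow> 'p set \<Rightarrow> real"
    and N mL mR :: nat
    and Q :: "nat set \<Rightarrow> real"
    and X Y :: "nat \<Rightarrow> nat set"
  assumes "geometric_states G bdry regions S"
    and "superbalanced_HEIs_TF G regions S"
    and "primitive_HEI G regions S N Q"
    and "superbalanced N Q"
    and "reduced_form N Q mL X mR Y"
  shows "(\<forall>l\<in>{1..mL}. \<exists>r\<in>{1..mR}. X l \<subset> Y r) \<and>
    (\<forall>Z. Z \<subseteq> {1..N} \<longrightarrow> card {l \<in> {1..mL}. Z \<subseteq> X l} \<le> card {r \<in> {1..mR}. Z \<subseteq> Y r}) \<and>
    (\<forall>l\<in>{1..mL}. \<exists>r\<in>{1..mR}. Y r \<subset> X l)"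
proof -
  interpret geometric_states G bdry regions S by fact
  have X: "X ` {1..mL} \<subseteq> subsystems N" and Y: "Y ` {1..mR} \<subseteq> subsystems N"
    and XY: "X ` {1..mL} \<inter> Y ` {1..mR} = {}"
    using assms(5) by (auto simp: reduced_form_def)
  have ne: "Y r \<noteq> X l" if "l \<in> {1..mL}" "r \<in> {1..mR}" for l r
    using XY that by blast
  obtain c where "c > 0" and c: "(\<lambda>V. c * Q V) = term_difference mL X mR Y"
    using assms(5) by (auto simp: reduced_form_def term_difference_def fun_eq_iff)
  have hei: "HEI G regions S N (term_difference mL X mR Y)"
    using HEI_scale[of G regions S N Q c] assms(3) \<open>c > 0\<close> by (simp add: primitive_HEI_def c)
  have bal: "superbalanced N (term_difference mL X mR Y)"
    using superbalanced_scale[OF assms(4), of c] by (simp add: c)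
  have "\<exists>r\<in>{1..mR}. X l \<subset> Y r" if "l \<in> {1..mL}" for l
    using dominating_term[OF assms(2) X Y hei bal that] ne[OF that] by blast
  moreover have "\<exists>r\<in>{1..mR}. Y r \<subset> X l" if l: "l \<in> {1..mL}" for l
  proof -
    have Xl: "X l \<in> subsystems N" using X l by blast
    \<comment> \<open>Any party of the non-empty \<open>X l\<close> serves; it has to lie in
      \<open>X l\<close> so that the swap complements this term.\<close>
    then obtain i where i: "i \<in> X l" "i \<in> {1..N}" unfolding subsystems_def by blast
    have "(\<lambda>l. purifier_swap N i (X l)) ` {1..mL} \<subseteq> subsystems N"
      "(\<lambda>r. purifier_swap N i (Y r)) ` {1..mR} \<subseteq> subsystems N"
      using X Y purifier_swap_mem_subsystems by blast+
    from dominating_term[OF assms(2) this HEI_purifier_swap[OF X Y hei i(2)]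
        superbalanced_purifier_swap[OF X Y bal i(2)] l]
    obtain r where r: "r \<in> {1..mR}" and "purifier_swap N i (X l) \<subseteq> purifier_swap N i (Y r)"
      by blast
    then have "Y r \<subset> X l"
      using psubset_of_purifier_swap[OF i(1) Xl _ ne[OF l r]] Y by blast
    then show ?thesis using r by blast
  qed
  ultimately show ?thesis
    using region_dominance[OF assms(2) X Y hei bal] by blast
qed

end
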